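(* For any (real or complex) constants $\alpha,\beta$ and $\eta$, $$e^{i\eta x^\beta}\;{}_1F_1\Bigl(1;\frac{\alpha+\beta+1}{\beta}; -i\eta x^{\beta}\Bigr)$$ $$=\frac{1}{\alpha+\beta+1}\Bigl[\cos(\eta x^\beta)\;{}_1F_2\Bigl(1; \frac{\alpha+\beta+1}{2\beta}, \frac{\alpha+2\beta+1}{2\beta}; -\frac{\eta^2 x^{2\beta}}{4}\Bigr)+ \beta\eta x^{\beta}\sin(\eta x^\beta)\;{}_1F_2\Bigl(1; \frac{\alpha+2\beta+1}{2\beta}, \frac{\alpha+3\beta+1}{2\beta}; -\frac{\eta^2 x^{2\beta}}{4}\Bigr)\Bigr]$$ $$+\frac{i}{\alpha+\beta+1}\Bigl[\sin(\eta x^\beta)\;{}_1F_2\Bigl(1; \frac{\alpha+\beta+1}{2\beta}, \frac{\alpha+2\beta+1}{2\beta}; -\frac{\eta^2 x^{2\beta}}{4}\Bigr)- \beta\eta x^{\beta}\cos(\eta x^\beta)\;{}_1F_2\Bigl(1; \frac{\alpha+2\beta+1}{2\beta}, \frac{\alpha+3\beta+1}{2\beta}; -\frac{\eta^2 x^{2\beta}}{4}\Bigr)\Bigr].$$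
   Context: ${}_1F_1(a;b;x)=\sum_{n=0}^{\infty}\frac{(a)_n}{(b)_n}\frac{x^n}{n!}$ and ${}_1F_2(a;b,c;x)=\sum_{n=0}^{\infty}\frac{(a)_n}{(b)_n(c)_n}\frac{x^n}{n!}$, where $(\vartheta)_n=\Gamma(\vartheta+n)/\Gamma(\vartheta)$, $(\vartheta)_0=1$ (Pochhammer symbol). The identity is an identity in the variable $x$.
   Formalization: The printed identity is false (α=β=η=1, x=0 gives 1 = 1/3); a factor α+β+1 is inserted on the cos and sin terms with the first 1F2, so these are not divided by α+β+1. Assumed: β≠0 and (α+β+1)/β not in {0,−1,−2,…}; x^β is the principal power. *)

theory Defs
  imports "HOL-Analysis.Analysis"
begin

text \<open>
  Hypergeometric series as functions of a complex argument. A denominator parameter in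
  \<open>\<int>\<^sub>\<le>\<^sub>0\<close> makes \<^const>\<open>pochhammer\<close> vanish from some index on; division by zero then silently
  drops these terms, so such parameters have to be excluded where the functions are used.
\<close>

definition hyp1F1 :: "complex \<Rightarrow> complex \<Rightarrow> complex \<Rightarrow> complex" where
  "hyp1F1 a b x = (\<Sum>n. pochhammer a n / pochhammer b n * (x ^ n / fact n))"

definition hyp1F2 :: "complex \<Rightarrow> complex \<Rightarrow> complex \<Rightarrow> complex \<Rightarrow> complex" where
  "hyp1F2 a b c x = (\<Sum>n. pochhammer a n / (pochhammer b n * pochhammer c n) * (x ^ n / fact n))"

lemma hyp1F1_conv_fps: "hyp1F1 a b x = eval_fps (fps_hypergeo [a] [b] 1) x"
  by (simp add: hyp1F1_def eval_fps_def)

lemma hyp1F2_conv_fps: "hyp1F2 a b c x = eval_fps (fps_hypergeo [a] [b, c] 1) x"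
  by (simp add: hyp1F2_def eval_fps_def algebra_simps)

lemma hyp1F1_0 [simp]: "hyp1F1 a b 0 = 1"
  unfolding hyp1F1_def by (subst suminf_finite[where N = "{0}"]) auto

lemma hyp1F2_0 [simp]: "hyp1F2 a b c 0 = 1"
  unfolding hyp1F2_def by (subst suminf_finite[where N = "{0}"]) auto

text \<open>
  In the source, the identity formalized here is printed without the factor
  \<open>\<alpha> + \<beta> + 1\<close> in front of the two terms that contain the first \<open>hyp1F2\<close>, i.e. the prefactor
  \<open>1 / (\<alpha> + \<beta> + 1)\<close> also divides those terms. In that form it is false: in the following
  instance (with \<open>\<alpha> = \<beta> = \<eta> = 1\<close> and \<open>x = 0\<close>) the left-hand side is 1 and the right-hand
  side is 1/3. The formal statement therefore includes that factor.
\<close>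

lemma identity_without_factor_fails:
  defines "\<alpha> \<equiv> 1 :: complex" and "\<beta> \<equiv> 1 :: complex" and "\<eta> \<equiv> 1 :: complex" and "x \<equiv> 0 :: complex"
  shows "exp (\<i> * \<eta> * x powr \<beta>) * hyp1F1 1 ((\<alpha> + \<beta> + 1) / \<beta>) (- \<i> * \<eta> * x powr \<beta>) \<noteq>
      1 / (\<alpha> + \<beta> + 1) *
        (cos (\<eta> * x powr \<beta>) *
           hyp1F2 1 ((\<alpha> + \<beta> + 1) / (2 * \<beta>)) ((\<alpha> + 2 * \<beta> + 1) / (2 * \<beta>)) (- (\<eta>\<^sup>2 * x powr (2 * \<beta>)) / 4)
         + \<beta> * \<eta> * x powr \<beta> * sin (\<eta> * x powr \<beta>) *
           hyp1F2 1 ((\<alpha> + 2 * \<beta> + 1) / (2 * \<beta>)) ((\<alpha> + 3 * \<beta> + 1) / (2 * \<beta>)) (- (\<eta>\<^sup>2 * x powr (2 * \<beta>)) / 4))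
    + \<i> / (\<alpha> + \<beta> + 1) *
        (sin (\<eta> * x powr \<beta>) *
           hyp1F2 1 ((\<alpha> + \<beta> + 1) / (2 * \<beta>)) ((\<alpha> + 2 * \<beta> + 1) / (2 * \<beta>)) (- (\<eta>\<^sup>2 * x powr (2 * \<beta>)) / 4)
         - \<beta> * \<eta> * x powr \<beta> * cos (\<eta> * x powr \<beta>) *
           hyp1F2 1 ((\<alpha> + 2 * \<beta> + 1) / (2 * \<beta>)) ((\<alpha> + 3 * \<beta> + 1) / (2 * \<beta>)) (- (\<eta>\<^sup>2 * x powr (2 * \<beta>)) / 4))"
  by (simp add: \<alpha>_def \<beta>_def \<eta>_def x_def)

end

theory Submission
  imports Defs
begin

text \<open>
  Since \<open>(1)\<^sub>n = n!\<close>, the series of \<open>\<^sub>1F\<^sub>1(1; b; w)\<close> is \<open>\<Sum> w\<^sup>n / (b)\<^sub>n\<close>. Its even and odd parts are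
  \<open>\<^sub>1F\<^sub>2\<close> series by the duplication formula \<open>(b)\<^sub>2\<^sub>k = 4\<^sup>k (b/2)\<^sub>k ((b+1)/2)\<^sub>k\<close>. The identity is
  this splitting at \<open>w = - i \<eta> x\<^sup>\<beta>\<close>, multiplied by Euler's formula for \<open>exp (i \<eta> x\<^sup>\<beta>)\<close>.
\<close>

text \<open>Ratio test: the quotient of consecutive terms is \<open>w / (b + of_nat n)\<close>,
  which tends to 0. If \<open>b\<close> is a nonpositive integer, the terms are 0 from some index
  on, since division by 0 gives 0.\<close>

lemma summable_norm_power_div_pochhammer:
  fixes b w :: complex
  shows "summable (\<lambda>n. norm (w ^ n / pochhammer b n))"
proof (rule summable_ratio_test)
  show "(1/2 :: real) < 1" by simp
next
  fix n :: nat
  \<comment> \<open>From this index on, \<open>norm (b + of_nat n)\<close> is at least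
    \<open>real n - norm b\<close> \<ge> \<open>2 * norm w\<close>, which bounds the quotient by
    1/2.\<close>
  assume "n \<ge> nat \<lceil>norm b + 2 * norm w\<rceil>"
  then have "norm b + 2 * norm w \<le> real n" by linarith
  moreover have "real n - norm b \<le> norm (b + of_nat n)"
    using norm_diff_ineq[of "of_nat n :: complex" b] by (simp add: add.commute)
  ultimately have "2 * norm w \<le> norm (b + of_nat n)" by linarith
  then have "norm (w / (b + of_nat n)) \<le> 1/2"
    by (cases "b + of_nat n = 0") (auto simp: norm_divide field_simps)
  then have "norm (w / (b + of_nat n)) * norm (w ^ n / pochhammer b n)
      \<le> 1/2 * norm (w ^ n / pochhammer b n)"
    by (rule mult_right_mono) simp
  then show "norm (norm (w ^ Suc n / pochhammer b (Suc n))) \<le> 1/2 * norm (norm (w ^ n / pochhammer b n))"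
    by (simp add: pochhammer_rec' norm_mult norm_divide)
qed

text \<open>Absolute convergence passes to both subseries, and a convergent series may be grouped
  into blocks of two consecutive terms.\<close>

lemma suminf_even_odd:
  fixes f :: "nat \<Rightarrow> 'a::banach"
  assumes "summable (\<lambda>n. norm (f n))"
  shows "suminf f = (\<Sum>n. f (2 * n)) + (\<Sum>n. f (Suc (2 * n)))"
proof -
  have even: "summable (\<lambda>n. f (2 * n))"
    by (rule summable_norm_cancel) (use summable_reindex[OF assms, of "\<lambda>n. 2 * n"] in
      \<open>simp add: o_def inj_on_def\<close>)
  have odd: "summable (\<lambda>n. f (Suc (2 * n)))"
    by (rule summable_norm_cancel) (use summable_reindex[OF assms, of "\<lambda>n. Suc (2 * n)"] in
      \<open>simp add: o_def inj_on_def\<close>)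
  have "f sums suminf f"
    using summable_norm_cancel[OF assms] by (rule summable_sums)
  then have "(\<lambda>n. sum f {n * 2..<n * 2 + 2}) sums suminf f"
    by (rule sums_group) simp
  moreover have "sum f {n * 2..<n * 2 + 2} = f (2 * n) + f (Suc (2 * n))" for n
    by (simp add: mult.commute)
  ultimately have "suminf f = (\<Sum>n. f (2 * n) + f (Suc (2 * n)))"
    by (simp add: sums_unique)
  then show ?thesis
    using suminf_add[OF even odd] by simp
qed

lemma hyp1F1_1_conv: "hyp1F1 1 b w = (\<Sum>n. w ^ n / pochhammer b n)"
  by (simp add: hyp1F1_def flip: pochhammer_fact)

lemma hyp1F2_1_conv:
  "hyp1F2 1 (b / 2) ((b + 1) / 2) (w\<^sup>2 / 4) = (\<Sum>n. w ^ (2 * n) / pochhammer b (2 * n))"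
proof -
  have "(w\<^sup>2 / 4) ^ n / (pochhammer (b / 2) n * pochhammer ((b + 1) / 2) n)
      = w ^ (2 * n) / pochhammer b (2 * n)" for n
  proof -
    have "pochhammer b (2 * n) = 4 ^ n * (pochhammer (b / 2) n * pochhammer ((b + 1) / 2) n)"
      using pochhammer_double[of "b / 2" n] by (simp add: power_mult add_divide_distrib)
    then show ?thesis
      by (simp add: power_mult[of w] power_divide)
  qed
  then show ?thesis
    by (simp add: hyp1F2_def flip: pochhammer_fact)
qed

text \<open>Since \<open>pochhammer b (Suc (2 * n)) = b * pochhammer (b + 1) (2 * n)\<close>, the
  odd part is \<open>w / b\<close> times the even part of the series with \<open>b + 1\<close> in
  place of \<open>b\<close>.\<close>

lemma hyp1F1_1_eq_hyp1F2:
  "hyp1F1 1 b w = hyp1F2 1 (b / 2) ((b + 1) / 2) (w\<^sup>2 / 4)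
     + w / b * hyp1F2 1 ((b + 1) / 2) ((b + 2) / 2) (w\<^sup>2 / 4)"
proof -
  \<comment> \<open>Convergence justifies pulling the constant \<open>w / b\<close> out of the
    infinite sum.\<close>
  have "summable (\<lambda>n. w ^ (2 * n) / pochhammer (b + 1) (2 * n))"
    by (rule summable_norm_cancel) (use summable_reindex[OF summable_norm_power_div_pochhammer[of w "b + 1"], of "\<lambda>n. 2 * n"] in
      \<open>simp add: o_def inj_on_def\<close>)
  then have "(\<Sum>n. w ^ Suc (2 * n) / pochhammer b (Suc (2 * n)))
      = w / b * (\<Sum>n. w ^ (2 * n) / pochhammer (b + 1) (2 * n))"
    by (subst suminf_mult[symmetric]) (simp_all add: pochhammer_rec)
  then show ?thesis
    unfolding hyp1F1_1_conv suminf_even_odd[OF summable_norm_power_div_pochhammer] hyp1F2_1_conv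
    using hyp1F2_1_conv[of "b + 1" w] by (simp add: add.assoc)
qed

theorem theorem7:
  fixes \<alpha> \<beta> \<eta> x :: complex
  assumes "\<beta> \<noteq> 0"
    and "(\<alpha> + \<beta> + 1) / \<beta> \<notin> \<int>\<^sub>\<le>\<^sub>0"
  shows "exp (\<i> * \<eta> * x powr \<beta>) * hyp1F1 1 ((\<alpha> + \<beta> + 1) / \<beta>) (- \<i> * \<eta> * x powr \<beta>) =
      1 / (\<alpha> + \<beta> + 1) *
        ((\<alpha> + \<beta> + 1) * cos (\<eta> * x powr \<beta>) *
           hyp1F2 1 ((\<alpha> + \<beta> + 1) / (2 * \<beta>)) ((\<alpha> + 2 * \<beta> + 1) / (2 * \<beta>)) (- (\<eta>\<^sup>2 * x powr (2 * \<beta>)) / 4)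
         + \<beta> * \<eta> * x powr \<beta> * sin (\<eta> * x powr \<beta>) *
           hyp1F2 1 ((\<alpha> + 2 * \<beta> + 1) / (2 * \<beta>)) ((\<alpha> + 3 * \<beta> + 1) / (2 * \<beta>)) (- (\<eta>\<^sup>2 * x powr (2 * \<beta>)) / 4))
    + \<i> / (\<alpha> + \<beta> + 1) *
        ((\<alpha> + \<beta> + 1) * sin (\<eta> * x powr \<beta>) *
           hyp1F2 1 ((\<alpha> + \<beta> + 1) / (2 * \<beta>)) ((\<alpha> + 2 * \<beta> + 1) / (2 * \<beta>)) (- (\<eta>\<^sup>2 * x powr (2 * \<beta>)) / 4)
         - \<beta> * \<eta> * x powr \<beta> * cos (\<eta> * x powr \<beta>) *
           hyp1F2 1 ((\<alpha> + 2 * \<beta> + 1) / (2 * \<beta>)) ((\<alpha> + 3 * \<beta> + 1) / (2 * \<beta>)) (- (\<eta>\<^sup>2 * x powr (2 * \<beta>)) / 4))"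
proof -
  define z where "z = \<eta> * x powr \<beta>"
  define b where "b = (\<alpha> + \<beta> + 1) / \<beta>"
  define E where "E = hyp1F2 1 (b / 2) ((b + 1) / 2) (- z\<^sup>2 / 4)"
  define F where "F = hyp1F2 1 ((b + 1) / 2) ((b + 2) / 2) (- z\<^sup>2 / 4)"
  \<comment> \<open>0 counts as a nonpositive integer, so the assumption on the lower parameter
    rules this case out.\<close>
  have nz: "\<alpha> + \<beta> + 1 \<noteq> 0"
  proof
    assume "\<alpha> + \<beta> + 1 = 0"
    then have "(\<alpha> + \<beta> + 1) / \<beta> = 0" by simp
    with assms(2) show False by simp
  qed
  have params: "(\<alpha> + \<beta> + 1) / (2 * \<beta>) = b / 2" "(\<alpha> + 2 * \<beta> + 1) / (2 * \<beta>) = (b + 1) / 2"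
      "(\<alpha> + 3 * \<beta> + 1) / (2 * \<beta>) = (b + 2) / 2"
    using assms(1) by (simp_all add: b_def field_simps)
  \<comment> \<open>Both powers are built from the same logarithm of \<open>x\<close>, so squaring
    \<open>x powr \<beta>\<close> raises no branch issue; at \<open>x = 0\<close> both sides are
    0.\<close>
  have arg: "- (\<eta>\<^sup>2 * x powr (2 * \<beta>)) / 4 = - z\<^sup>2 / 4"
    by (simp add: z_def power_mult_distrib power2_eq_square flip: powr_add)
  \<comment> \<open>The complex product in abstract letters: \<open>d\<close> stands for
    \<open>\<alpha> + \<beta> + 1\<close>, \<open>u\<close> for \<open>\<beta> * z\<close>. It
    becomes a polynomial identity modulo \<open>inverse d * d = 1\<close> and
    \<open>\<i> * \<i> = -1\<close>.\<close>
  have euler_mult: "(c + \<i> * s) * (e - \<i> * (u / d) * f)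
      = 1 / d * (d * c * e + u * s * f) + \<i> / d * (d * s * e - u * c * f)"
    if "d \<noteq> 0" for c s e u f d :: complex
  proof -
    have "inverse d * d = 1" "\<i> * \<i> = -1"
      using that by simp_all
    then show ?thesis
      unfolding divide_inverse by algebra
  qed
  \<comment> \<open>The denominator \<open>\<alpha> + \<beta> + 1\<close> arises only here, in the
    odd part; hence the terms with \<open>E\<close> carry a factor cancelling the common
    prefactor.\<close>
  have zb: "z / b = \<beta> * z / (\<alpha> + \<beta> + 1)"
    by (simp add: b_def)
  \<comment> \<open>The splitting at \<open>w = - \<i> * z\<close>, where
    \<open>w\<^sup>2 = - z\<^sup>2\<close>.\<close>
  have "hyp1F1 1 b (- \<i> * z) = E - \<i> * (z / b) * F"
    by (simp add: hyp1F1_1_eq_hyp1F2 E_def F_def power_mult_distrib)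
  then have "exp (\<i> * z) * hyp1F1 1 b (- \<i> * z)
      = (cos z + \<i> * sin z) * (E - \<i> * (\<beta> * z / (\<alpha> + \<beta> + 1)) * F)"
    by (simp only: exp_Euler zb)
  also have "\<dots> = 1 / (\<alpha> + \<beta> + 1) * ((\<alpha> + \<beta> + 1) * cos z * E + \<beta> * z * sin z * F)
      + \<i> / (\<alpha> + \<beta> + 1) * ((\<alpha> + \<beta> + 1) * sin z * E - \<beta> * z * cos z * F)"
    using euler_mult[OF nz, of "cos z" "sin z" E "\<beta> * z" F] by simp
  finally show ?thesis
    unfolding params arg E_def[symmetric] F_def[symmetric] b_def[symmetric]
    by (simp add: z_def mult.assoc)
qed

end
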